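(* Let $n\ge 1$, let $F_0,F_1,\dots,F_n$ be locally convex Hausdorff spaces, let $C_j$ be a densely defined linear operator from $F_0$ to $F_j$ for $j=1,\dots,n$, and let $C=C_{C_1,\dots,C_n}$ be the associated column operator, assumed to be densely defined. Assume that at most one of the entries $C_j$ fails to belong to $\mathfrak B(F_0,F_j)$. Then $C^\times=C'$.
   Context: Operators are linear and defined on linear subspaces; $\mathcal D(T)$ is the domain of $T$. $\mathfrak B(X,Y)$ denotes the everywhere defined continuous linear operators from $X$ to $Y$. The column operator $C=C_{C_1,\dots,C_n}$ from $F_0$ to $\bigoplus_{j=1}^nF_j$ has domain $\mathcal D(C)=\bigcap_{j=1}^n\mathcal D(C_j)$ and $Cf=\bigoplus_{j=1}^n C_jf$. For a densely defined operator $T$ from $X$ to $Y$, the adjoint $T'$ is the operator from the topological dual $Y'$ to $X'$ with $\mathcal D(T')=\{g\in Y' : \exists h\in X' \ \forall f\in\mathcal D(T)\ \langle Tf,g\rangle=\langle f,h\rangle\}$ and $T'g=h$. The dual of a finite direct sum is identified with the direct sum of the duals. $C^\times$ is the row operator from $\bigoplus_{j=1}^nF_j'$ to $F_0'$ with domain $\bigoplus_{j=1}^n\mathcal D(C_j')$ and $C^\times(\oplus_jg_j)=\sum_{j=1}^nC_j'g_j$. Equality of operators includes equality of domains. *)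

theory Defs
  imports "HOL-Analysis.Analysis" "HOL-Algebra.Module"
begin

text \<open>
  Spaces are carrier-based, so that a family of spaces \<open>F 1, ..., F n\<close> whose members have
  nothing to do with each other can be indexed by a natural number. The scalars form a type
  of class \<^class>\<open>real_normed_field\<close>; by the theorem of Gelfand and Mazur the
  instances of this class are, up to isometric isomorphism, exactly the real and the complex
  numbers.
  The ring multiplication and unit that the record type \<open>module\<close> carries along are never used.
\<close>

definition scalar_ring :: "'k::real_normed_field ring" where
  "scalar_ring = \<lparr>carrier = UNIV, mult = (*), one = 1, zero = 0, add = (+)\<rparr>"

record ('k, 'v) tvs = "('k, 'v) module" +
  topo :: "'v topology"

definition convex_in :: "('k::real_normed_field, 'v) tvs \<Rightarrow> 'v set \<Rightarrow> bool" where
  "convex_in X U \<longleftrightarrow> (\<forall>x\<in>U. \<forall>y\<in>U. \<forall>t\<in>{0..1::real}.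
     (of_real (1 - t) \<odot>\<^bsub>X\<^esub> x) \<oplus>\<^bsub>X\<^esub> (of_real t \<odot>\<^bsub>X\<^esub> y) \<in> U)"

locale lc_hausdorff_space =
  module scalar_ring X
  for X :: "('k::real_normed_field, 'v) tvs" (structure) +
  assumes topspace_topo: "topspace (topo X) = carrier X"
    and continuous_add:
      "continuous_map (prod_topology (topo X) (topo X)) (topo X) (\<lambda>(x, y). x \<oplus> y)"
    and continuous_smult:
      "continuous_map (prod_topology euclidean (topo X)) (topo X) (\<lambda>(a::'k, x). a \<odot> x)"
    and hausdorff: "Hausdorff_space (topo X)"
    and locally_convex: "neighbourhood_base_at \<zero> (convex_in X) (topo X)"

text \<open>
  The direct sum is only used for a finite index set, where its topology is the product
  topology.
\<close>

definition direct_sum :: "'i set \<Rightarrow> ('i \<Rightarrow> ('k, 'v) tvs) \<Rightarrow> ('k, 'i \<Rightarrow> 'v) tvs" where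
  "direct_sum I F = \<lparr>
     carrier = (\<Pi>\<^sub>E j\<in>I. carrier (F j)),
     mult = undefined,
     one = undefined,
     zero = (\<lambda>j\<in>I. \<zero>\<^bsub>F j\<^esub>),
     add = (\<lambda>x y. \<lambda>j\<in>I. x j \<oplus>\<^bsub>F j\<^esub> y j),
     smult = (\<lambda>a x. \<lambda>j\<in>I. a \<odot>\<^bsub>F j\<^esub> x j),
     topo = product_topology (\<lambda>j. topo (F j)) I\<rparr>"

text \<open>
  The topological dual as a vector space. Its elements are functions that are
  \<^const>\<open>undefined\<close> outside of the carrier. No topology on the dual is needed:
  adjoints are defined purely algebraically in terms of it.
\<close>

definition dual_space ::
    "('k::real_normed_field, 'v) tvs \<Rightarrow> ('k, 'v \<Rightarrow> 'k) module" where
  "dual_space X = \<lparr>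
     carrier = {\<phi> \<in> extensional (carrier X).
       (\<forall>x\<in>carrier X. \<forall>y\<in>carrier X. \<phi> (x \<oplus>\<^bsub>X\<^esub> y) = \<phi> x + \<phi> y) \<and>
       (\<forall>a. \<forall>x\<in>carrier X. \<phi> (a \<odot>\<^bsub>X\<^esub> x) = a * \<phi> x) \<and>
       continuous_map (topo X) euclidean \<phi>},
     mult = undefined,
     one = undefined,
     zero = (\<lambda>x\<in>carrier X. 0),
     add = (\<lambda>\<phi> \<psi>. \<lambda>x\<in>carrier X. \<phi> x + \<psi> x),
     smult = (\<lambda>a \<phi>. \<lambda>x\<in>carrier X. a * \<phi> x)\<rparr>"

text \<open>
  An operator is a partial function, whose domain is \<^const>\<open>dom\<close>. Hence equality of
  operators includes equality of the domains.
\<close>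

definition linear_operator ::
    "('k::real_normed_field, 'v) tvs \<Rightarrow> ('k, 'w) tvs \<Rightarrow> ('v \<rightharpoonup> 'w) \<Rightarrow> bool" where
  "linear_operator X Y T \<longleftrightarrow>
     submodule (dom T) scalar_ring X \<and> ran T \<subseteq> carrier Y \<and>
     (\<forall>x\<in>dom T. \<forall>y\<in>dom T. the (T (x \<oplus>\<^bsub>X\<^esub> y)) = the (T x) \<oplus>\<^bsub>Y\<^esub> the (T y)) \<and>
     (\<forall>a. \<forall>x\<in>dom T. the (T (a \<odot>\<^bsub>X\<^esub> x)) = a \<odot>\<^bsub>Y\<^esub> the (T x))"

definition densely_defined :: "('k, 'v) tvs \<Rightarrow> ('v \<rightharpoonup> 'w) \<Rightarrow> bool" where
  "densely_defined X T \<longleftrightarrow> topo X closure_of dom T = carrier X"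

definition continuous_operators ::
    "('k::real_normed_field, 'v) tvs \<Rightarrow> ('k, 'w) tvs \<Rightarrow> ('v \<rightharpoonup> 'w) set" where
  "continuous_operators X Y = {T. linear_operator X Y T \<and> dom T = carrier X \<and>
     continuous_map (topo X) (topo Y) (\<lambda>x. the (T x))}"

definition column_operator :: "'i set \<Rightarrow> ('i \<Rightarrow> 'v \<rightharpoonup> 'w) \<Rightarrow> 'v \<rightharpoonup> ('i \<Rightarrow> 'w)" where
  "column_operator I C = (\<lambda>f.
     if f \<in> (\<Inter>j\<in>I. dom (C j)) then Some (\<lambda>j\<in>I. the (C j f)) else None)"

definition row_operator ::
    "('k, 'w, 'm) module_scheme \<Rightarrow> 'i set \<Rightarrow> ('i \<Rightarrow> 'v \<rightharpoonup> 'w) \<Rightarrow> ('i \<Rightarrow> 'v) \<rightharpoonup> 'w" where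
  "row_operator Y I R = (\<lambda>g.
     if g \<in> (\<Pi>\<^sub>E j\<in>I. dom (R j)) then Some (\<Oplus>\<^bsub>Y\<^esub> j\<in>I. the (R j (g j))) else None)"

text \<open>The functional \<open>h\<close> below is unique if \<open>T\<close> is densely defined.\<close>

definition adjoint_rel ::
    "('k::real_normed_field, 'v) tvs \<Rightarrow> ('k, 'w) tvs \<Rightarrow> ('v \<rightharpoonup> 'w) \<Rightarrow>
      ('w \<Rightarrow> 'k) \<Rightarrow> ('v \<Rightarrow> 'k) \<Rightarrow> bool" where
  "adjoint_rel X Y T g h \<longleftrightarrow>
     g \<in> carrier (dual_space Y) \<and> h \<in> carrier (dual_space X) \<and>
     (\<forall>f\<in>dom T. g (the (T f)) = h f)"

definition adjoint_op ::
    "('k::real_normed_field, 'v) tvs \<Rightarrow> ('k, 'w) tvs \<Rightarrow> ('v \<rightharpoonup> 'w) \<Rightarrow>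
      ('w \<Rightarrow> 'k) \<rightharpoonup> ('v \<Rightarrow> 'k)" where
  "adjoint_op X Y T = (\<lambda>g.
     if \<exists>h. adjoint_rel X Y T g h then Some (THE h. adjoint_rel X Y T g h) else None)"

definition column_cross ::
    "('k::real_normed_field, 'v) tvs \<Rightarrow> 'i set \<Rightarrow> ('i \<Rightarrow> ('k, 'w) tvs) \<Rightarrow>
      ('i \<Rightarrow> 'v \<rightharpoonup> 'w) \<Rightarrow> ('i \<Rightarrow> 'w \<Rightarrow> 'k) \<rightharpoonup> ('v \<Rightarrow> 'k)" where
  "column_cross X I F C = row_operator (dual_space X) I (\<lambda>j. adjoint_op X (F j) (C j))"

text \<open>
  The identification of the direct sum of the duals with the dual of the direct sum, as an
  everywhere defined operator on the direct sum of the duals.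
\<close>

definition dual_sum_iso ::
    "'i set \<Rightarrow> ('i \<Rightarrow> ('k::real_normed_field, 'v) tvs) \<Rightarrow>
      ('i \<Rightarrow> 'v \<Rightarrow> 'k) \<rightharpoonup> (('i \<Rightarrow> 'v) \<Rightarrow> 'k)" where
  "dual_sum_iso I F = (\<lambda>g.
     if g \<in> (\<Pi>\<^sub>E j\<in>I. carrier (dual_space (F j)))
     then Some (\<lambda>x\<in>carrier (direct_sum I F). \<Sum>j\<in>I. g j (x j)) else None)"

lemma dual_spaceD:
  assumes "\<phi> \<in> carrier (dual_space X)"
  shows "\<phi> \<in> extensional (carrier X)"
    and "\<And>x y. x \<in> carrier X \<Longrightarrow> y \<in> carrier X \<Longrightarrow> \<phi> (x \<oplus>\<^bsub>X\<^esub> y) = \<phi> x + \<phi> y"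
    and "\<And>a x. x \<in> carrier X \<Longrightarrow> \<phi> (a \<odot>\<^bsub>X\<^esub> x) = a * \<phi> x"
    and "continuous_map (topo X) euclidean \<phi>"
  using assms by (auto simp: dual_space_def)

lemma dual_spaceI:
  assumes "\<phi> \<in> extensional (carrier X)"
    and "\<And>x y. x \<in> carrier X \<Longrightarrow> y \<in> carrier X \<Longrightarrow> \<phi> (x \<oplus>\<^bsub>X\<^esub> y) = \<phi> x + \<phi> y"
    and "\<And>a x. x \<in> carrier X \<Longrightarrow> \<phi> (a \<odot>\<^bsub>X\<^esub> x) = a * \<phi> x"
    and "continuous_map (topo X) euclidean \<phi>"
  shows "\<phi> \<in> carrier (dual_space X)"
  using assms by (auto simp: dual_space_def)

lemma direct_sum_simps [simp]:
  "carrier (direct_sum I F) = (\<Pi>\<^sub>E j\<in>I. carrier (F j))"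
  "zero (direct_sum I F) = (\<lambda>j\<in>I. \<zero>\<^bsub>F j\<^esub>)"
  "add (direct_sum I F) x y = (\<lambda>j\<in>I. x j \<oplus>\<^bsub>F j\<^esub> y j)"
  "smult (direct_sum I F) a x = (\<lambda>j\<in>I. a \<odot>\<^bsub>F j\<^esub> x j)"
  "topo (direct_sum I F) = product_topology (\<lambda>j. topo (F j)) I"
  by (simp_all add: direct_sum_def)

lemma dual_sum_iso_in_dual:
  fixes F :: "'i \<Rightarrow> ('k::real_normed_field, 'v) tvs"
  assumes F: "\<And>j. j \<in> I \<Longrightarrow> lc_hausdorff_space (F j)"
    and I: "finite I" and g: "g \<in> (\<Pi>\<^sub>E j\<in>I. carrier (dual_space (F j)))"
  shows "(\<lambda>x\<in>carrier (direct_sum I F). \<Sum>j\<in>I. g j (x j)) \<in> carrier (dual_space (direct_sum I F))"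
    (is "?\<phi> \<in> _")
proof (rule dual_spaceI)
  have mods: "module scalar_ring (F j)" if "j \<in> I" for j
    using F[OF that] by (simp add: lc_hausdorff_space_def)
  have top: "topspace (topo (F j)) = carrier (F j)" if "j \<in> I" for j
    using F[OF that] by (rule lc_hausdorff_space.topspace_topo)
  have gd: "g j \<in> carrier (dual_space (F j))" if "j \<in> I" for j
    using g that by auto
  have add_cl: "x j \<oplus>\<^bsub>F j\<^esub> y j \<in> carrier (F j)"
    if "j \<in> I" "x \<in> (\<Pi>\<^sub>E j\<in>I. carrier (F j))" "y \<in> (\<Pi>\<^sub>E j\<in>I. carrier (F j))" for x y j
  proof -
    interpret module scalar_ring "F j" by (rule mods[OF that(1)])
    show ?thesis using that by (auto intro!: a_closed)
  qed
  have smult_cl: "a \<odot>\<^bsub>F j\<^esub> x j \<in> carrier (F j)"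
    if "j \<in> I" "x \<in> (\<Pi>\<^sub>E j\<in>I. carrier (F j))" for x j a
  proof -
    interpret module scalar_ring "F j" by (rule mods[OF that(1)])
    show ?thesis using that by (auto intro!: smult_closed simp: scalar_ring_def)
  qed
  show "?\<phi> \<in> extensional (carrier (direct_sum I F))" by auto
  show "?\<phi> (x \<oplus>\<^bsub>direct_sum I F\<^esub> y) = ?\<phi> x + ?\<phi> y"
    if "x \<in> carrier (direct_sum I F)" "y \<in> carrier (direct_sum I F)" for x y
  proof -
    have "(\<Sum>j\<in>I. g j (x j \<oplus>\<^bsub>F j\<^esub> y j)) = (\<Sum>j\<in>I. g j (x j) + g j (y j))"
      using that by (intro sum.cong refl dual_spaceD(2)[OF gd]) auto
    thus ?thesis using that add_cl[of _ x y] by (auto simp: sum.distrib)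
  qed
  show "?\<phi> (a \<odot>\<^bsub>direct_sum I F\<^esub> x) = a * ?\<phi> x"
    if "x \<in> carrier (direct_sum I F)" for a x
  proof -
    have "(\<Sum>j\<in>I. g j (a \<odot>\<^bsub>F j\<^esub> x j)) = (\<Sum>j\<in>I. a * g j (x j))"
      using that by (intro sum.cong refl dual_spaceD(3)[OF gd]) auto
    thus ?thesis using that smult_cl[of _ x a] by (auto simp: sum_distrib_left)
  qed
  have "continuous_map (product_topology (\<lambda>j. topo (F j)) I) euclidean (\<lambda>x. \<Sum>j\<in>I. g j (x j))"
  proof (rule continuous_map_sum[OF I])
    fix j assume j: "j \<in> I"
    have proj: "continuous_map (product_topology (\<lambda>j. topo (F j)) I) (topo (F j)) (\<lambda>x. x j)"
      using j by (rule continuous_map_product_projection)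
    show "continuous_map (product_topology (\<lambda>j. topo (F j)) I) euclidean (\<lambda>x. g j (x j))"
      using continuous_map_compose[OF proj dual_spaceD(4)[OF gd[OF j]]]
      by (simp add: o_def)
  qed
  thus "continuous_map (topo (direct_sum I F)) euclidean ?\<phi>"
    unfolding direct_sum_simps(5)
    by (rule continuous_map_eq) (use top in \<open>auto simp: topspace_product_topology PiE_iff\<close>)
qed

text \<open>
  Since the identification is a bijection, an operator on the direct sum of the duals and an
  operator on the dual of the direct sum are the same operator under it iff the former is the
  composition of the latter with \<^const>\<open>dual_sum_iso\<close>.
\<close>

lemma dual_sum_iso_bij:
  fixes F :: "'i \<Rightarrow> ('k::real_normed_field, 'v) tvs"
  assumes F: "\<And>j. j \<in> I \<Longrightarrow> lc_hausdorff_space (F j)" and I: "finite I"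
  shows "bij_betw (\<lambda>g. the (dual_sum_iso I F g)) (\<Pi>\<^sub>E j\<in>I. carrier (dual_space (F j)))
    (carrier (dual_space (direct_sum I F)))"
proof -
  let ?D = "\<Pi>\<^sub>E j\<in>I. carrier (dual_space (F j))"
  let ?S = "\<Pi>\<^sub>E j\<in>I. carrier (F j)"
  define \<iota> where "\<iota> j v = (\<lambda>i\<in>I. if i = j then v else \<zero>\<^bsub>F i\<^esub>)" for j v
  have mods: "module scalar_ring (F j)" if "j \<in> I" for j
    using F[OF that] by (simp add: lc_hausdorff_space_def)
  have ab: "abelian_group (F j)" if "j \<in> I" for j
    using mods[OF that] by (simp add: module_def)
  have top: "topspace (topo (F j)) = carrier (F j)" if "j \<in> I" for j
    using F[OF that] by (rule lc_hausdorff_space.topspace_topo)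
  have zcl: "\<zero>\<^bsub>F j\<^esub> \<in> carrier (F j)" if "j \<in> I" for j
    using ab[OF that] by (simp add: abelian_groupE(2))
  have zz: "\<zero>\<^bsub>F j\<^esub> \<oplus>\<^bsub>F j\<^esub> \<zero>\<^bsub>F j\<^esub> = \<zero>\<^bsub>F j\<^esub>" if "j \<in> I" for j
    using abelian_groupE(5)[OF ab[OF that]] zcl[OF that] by simp
  have lz: "\<zero>\<^bsub>F j\<^esub> \<oplus>\<^bsub>F j\<^esub> v = v" if "j \<in> I" "v \<in> carrier (F j)" for j v
    using abelian_groupE(5)[OF ab[OF that(1)] that(2)] .
  have rz: "v \<oplus>\<^bsub>F j\<^esub> \<zero>\<^bsub>F j\<^esub> = v" if "j \<in> I" "v \<in> carrier (F j)" for j v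
    using abelian_groupE(4)[OF ab[OF that(1)] that(2) zcl[OF that(1)]] lz[OF that] by simp
  have sz: "a \<odot>\<^bsub>F j\<^esub> \<zero>\<^bsub>F j\<^esub> = \<zero>\<^bsub>F j\<^esub>" if "j \<in> I" for j a
    using module.smult_r_null[OF mods[OF that]] by (simp add: scalar_ring_def)
  have \<iota>S: "\<iota> j v \<in> ?S" if "j \<in> I" "v \<in> carrier (F j)" for j v
    using that zcl by (auto simp: \<iota>_def)
  have zero0: "\<psi> \<zero>\<^bsub>F j\<^esub> = 0" if "j \<in> I" "\<psi> \<in> carrier (dual_space (F j))" for j \<psi>
    using dual_spaceD(2)[OF that(2) zcl[OF that(1)] zcl[OF that(1)]] zz[OF that(1)] by simp
  have iso: "the (dual_sum_iso I F g) = (\<lambda>x\<in>?S. \<Sum>j\<in>I. g j (x j))" if "g \<in> ?D" for g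
    using that by (simp add: dual_sum_iso_def)
  have ev: "the (dual_sum_iso I F g) (\<iota> j v) = g j v"
    if "g \<in> ?D" "j \<in> I" "v \<in> carrier (F j)" for g j v
  proof -
    have "(\<Sum>i\<in>I. g i (\<iota> j v i)) = (\<Sum>i\<in>I. if i = j then g j v else 0)"
      using that(1) by (intro sum.cong) (auto simp: \<iota>_def intro!: zero0)
    also have "\<dots> = g j v" using I that(2) by simp
    finally show ?thesis using iso[OF that(1)] \<iota>S[OF that(2,3)] by simp
  qed
  show ?thesis
  proof (rule bij_betw_imageI)
    show "inj_on (\<lambda>g. the (dual_sum_iso I F g)) ?D"
    proof (rule inj_onI)
      fix g g' assume g: "g \<in> ?D" "g' \<in> ?D" and eq: "the (dual_sum_iso I F g) = the (dual_sum_iso I F g')"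
      show "g = g'"
      proof (rule PiE_ext[OF g])
        fix j assume j: "j \<in> I"
        have e: "g j \<in> extensional (carrier (F j))" "g' j \<in> extensional (carrier (F j))"
          using g j by (auto intro: dual_spaceD(1))
        show "g j = g' j"
          by (rule extensionalityI[OF e]) (use ev[OF g(1) j] ev[OF g(2) j] eq in metis)
      qed
    qed
    show "(\<lambda>g. the (dual_sum_iso I F g)) ` ?D = carrier (dual_space (direct_sum I F))"
    proof (intro subset_antisym subsetI)
      fix \<phi> assume "\<phi> \<in> (\<lambda>g. the (dual_sum_iso I F g)) ` ?D"
      then obtain g where "g \<in> ?D" "\<phi> = the (dual_sum_iso I F g)" by auto
      thus "\<phi> \<in> carrier (dual_space (direct_sum I F))"
        using dual_sum_iso_in_dual[where F = F and g = g, OF F I] iso by simp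
    next
      fix \<phi> assume \<phi>: "\<phi> \<in> carrier (dual_space (direct_sum I F))"
      note D = dual_spaceD[OF \<phi>, simplified]
      define g where "g = (\<lambda>j\<in>I. \<lambda>v\<in>carrier (F j). \<phi> (\<iota> j v))"
      have gD: "g \<in> ?D"
      proof (rule PiE_I)
        fix j assume j: "j \<in> I"
        interpret module scalar_ring "F j" by (rule mods[OF j])
        show "g j \<in> carrier (dual_space (F j))"
        proof (rule dual_spaceI)
          show "g j \<in> extensional (carrier (F j))" using j by (simp add: g_def)
          fix x assume x: "x \<in> carrier (F j)"
          { fix y assume y: "y \<in> carrier (F j)"
            have "\<iota> j (x \<oplus>\<^bsub>F j\<^esub> y) = (\<lambda>i\<in>I. \<iota> j x i \<oplus>\<^bsub>F i\<^esub> \<iota> j y i)"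
              using zz by (auto simp: \<iota>_def fun_eq_iff)
            thus "g j (x \<oplus>\<^bsub>F j\<^esub> y) = g j x + g j y"
              using D(2)[OF \<iota>S[OF j x] \<iota>S[OF j y]] x y j by (simp add: g_def) }
          fix a
          have "\<iota> j (a \<odot>\<^bsub>F j\<^esub> x) = (\<lambda>i\<in>I. a \<odot>\<^bsub>F i\<^esub> \<iota> j x i)"
            using sz by (auto simp: \<iota>_def fun_eq_iff)
          moreover have "a \<odot>\<^bsub>F j\<^esub> x \<in> carrier (F j)"
            using x by (intro smult_closed) (auto simp: scalar_ring_def)
          ultimately show "g j (a \<odot>\<^bsub>F j\<^esub> x) = a * g j x"
            using D(3)[OF \<iota>S[OF j x], of a] x j by (simp add: g_def)
        next
          have "continuous_map (topo (F j)) (product_topology (\<lambda>j. topo (F j)) I) (\<iota> j)"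
          proof (subst continuous_map_componentwise, intro conjI ballI)
            show "\<iota> j ` topspace (topo (F j)) \<subseteq> extensional I" by (auto simp: \<iota>_def)
            fix i assume i: "i \<in> I"
            show "continuous_map (topo (F j)) (topo (F i)) (\<lambda>v. \<iota> j v i)"
              using i top[OF i] zcl[OF i] by (cases "i = j") (auto simp: \<iota>_def)
          qed
          from continuous_map_compose[OF this D(4)]
          show "continuous_map (topo (F j)) euclidean (g j)"
            by (rule continuous_map_eq) (use top[OF j] j in \<open>auto simp: g_def\<close>)
        qed
      qed (simp add: g_def)
      have dec: "\<phi> (\<lambda>i\<in>I. if i \<in> J then x i else \<zero>\<^bsub>F i\<^esub>) = (\<Sum>j\<in>J. \<phi> (\<iota> j (x j)))"
        if "J \<subseteq> I" "x \<in> ?S" for J x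
        using finite_subset[OF that(1) I] that(1)
      proof (induction J rule: finite_induct)
        case empty
        let ?z = "\<lambda>i\<in>I. \<zero>\<^bsub>F i\<^esub>"
        have "?z \<in> ?S" using zcl by auto
        moreover have "(\<lambda>i\<in>I. ?z i \<oplus>\<^bsub>F i\<^esub> ?z i) = ?z" using zz by (auto simp: fun_eq_iff)
        ultimately have "\<phi> ?z = \<phi> ?z + \<phi> ?z" using D(2)[of ?z ?z] by simp
        thus ?case by (simp add: restrict_def)
      next
        case (insert j J)
        let ?u = "\<lambda>i\<in>I. if i \<in> J then x i else \<zero>\<^bsub>F i\<^esub>"
        have j: "j \<in> I" and xj: "x j \<in> carrier (F j)" using insert.prems that(2) by auto
        have u: "?u \<in> ?S" using zcl that(2) by auto
        have "(\<lambda>i\<in>I. if i \<in> insert j J then x i else \<zero>\<^bsub>F i\<^esub>) = (\<lambda>i\<in>I. \<iota> j (x j) i \<oplus>\<^bsub>F i\<^esub> ?u i)"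
          using insert.hyps zz lz rz that(2) by (auto simp: \<iota>_def fun_eq_iff PiE_iff)
        moreover have "\<phi> ?u = (\<Sum>j\<in>J. \<phi> (\<iota> j (x j)))" using insert.IH insert.prems by blast
        ultimately show ?case
          using D(2)[OF \<iota>S[OF j xj] u] by (simp only: sum.insert[OF insert.hyps])
      qed
      have "the (dual_sum_iso I F g) = \<phi>"
      proof (rule extensionalityI)
        show "the (dual_sum_iso I F g) \<in> extensional ?S" by (simp add: iso[OF gD])
        show "\<phi> \<in> extensional ?S" by (rule D(1))
        fix x assume x: "x \<in> ?S"
        have "(\<lambda>i\<in>I. if i \<in> I then x i else \<zero>\<^bsub>F i\<^esub>) = x"
          using x by (auto simp: fun_eq_iff PiE_iff extensional_def)
        with dec[OF subset_refl x] have "\<phi> x = (\<Sum>j\<in>I. \<phi> (\<iota> j (x j)))" by simp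
        also have "\<dots> = (\<Sum>j\<in>I. g j (x j))" using x by (intro sum.cong) (auto simp: g_def)
        finally show "the (dual_sum_iso I F g) x = \<phi> x" using x by (simp add: iso[OF gD])
      qed
      thus "\<phi> \<in> (\<lambda>g. the (dual_sum_iso I F g)) ` ?D" using gD by (metis imageI)
    qed
  qed
qed

end

(*
  For a densely defined operator T, a functional h with <Tf, g> = <f, h> on the domain of T is
  unique, so both sides are determined by their graphs. Summing the defining relations of the C_j'
  shows that C^x is contained in C'. Conversely, let h = C'(g_1, ..., g_n), and let C_k be the
  only entry that may fail to be everywhere defined and continuous. Then C_j' g_j = g_j o C_j
  exists for all j other than k, the domain of C is that of C_k, and h - sum_{j /= k} C_j' g_j
  is therefore a continuous functional that represents g_k o C_k on the domain of C_k.
*)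

theory Submission
  imports Defs
begin

lemma dual_space_simps:
  "\<zero>\<^bsub>dual_space X\<^esub> = (\<lambda>x\<in>carrier X. 0)"
  "\<phi> \<oplus>\<^bsub>dual_space X\<^esub> \<psi> = (\<lambda>x\<in>carrier X. \<phi> x + \<psi> x)"
  by (simp_all add: dual_space_def)

lemma linear_operator_closed:
  assumes "linear_operator X Y T" and "f \<in> dom T"
  shows "the (T f) \<in> carrier Y"
  using assms ranI[of T f "the (T f)"] by (auto simp: linear_operator_def)

context lc_hausdorff_space
begin

lemma smult_closed' [simp]: "x \<in> carrier X \<Longrightarrow> a \<odot> x \<in> carrier X"
  by (rule smult_closed) (simp_all add: scalar_ring_def)

text \<open>Members of the dual are extensional, so every functional built below is cut off at the
  carrier. Continuity survives because the carrier is the whole topological space.\<close>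

lemma continuous_map_restrict_carrier:
  "continuous_map (topo X) Y f \<Longrightarrow> continuous_map (topo X) Y (restrict f (carrier X))"
  by (rule continuous_map_eq[of _ _ f]) (simp_all add: topspace_topo)

lemma zero_in_dual: "(\<lambda>x\<in>carrier X. 0) \<in> carrier (dual_space X)"
  by (rule dual_spaceI) (auto intro!: continuous_map_restrict_carrier)

lemma add_in_dual:
  assumes "\<phi> \<in> carrier (dual_space X)" "\<psi> \<in> carrier (dual_space X)"
  shows "(\<lambda>x\<in>carrier X. \<phi> x + \<psi> x) \<in> carrier (dual_space X)"
  by (rule dual_spaceI)
    (auto simp: dual_spaceD(2,3)[OF assms(1)] dual_spaceD(2,3)[OF assms(2)] algebra_simps
      intro!: continuous_map_restrict_carrier continuous_map_add
        dual_spaceD(4)[OF assms(1)] dual_spaceD(4)[OF assms(2)])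

lemma diff_in_dual:
  assumes "\<phi> \<in> carrier (dual_space X)" "\<psi> \<in> carrier (dual_space X)"
  shows "(\<lambda>x\<in>carrier X. \<phi> x - \<psi> x) \<in> carrier (dual_space X)"
  by (rule dual_spaceI)
    (auto simp: dual_spaceD(2,3)[OF assms(1)] dual_spaceD(2,3)[OF assms(2)] algebra_simps
      intro!: continuous_map_restrict_carrier continuous_map_diff
        dual_spaceD(4)[OF assms(1)] dual_spaceD(4)[OF assms(2)])

text \<open>The row operator adds with \<open>finsum\<close>, whose rules are stated for abelian
  monoids. The zero law rests on extensionality, as the sum is \<open>undefined\<close> off the
  carrier.\<close>

lemma abelian_monoid_dual: "abelian_monoid (dual_space X)"
proof (rule abelian_monoidI)
  fix \<phi> assume "\<phi> \<in> carrier (dual_space X)"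
  then show "\<zero>\<^bsub>dual_space X\<^esub> \<oplus>\<^bsub>dual_space X\<^esub> \<phi> = \<phi>"
    by (auto simp: dual_space_simps fun_eq_iff extensional_def dest: dual_spaceD(1))
qed (simp_all add: dual_space_simps zero_in_dual add_in_dual add_ac cong: restrict_cong)

lemma finsum_dual:
  assumes "finite I" and "\<And>j. j \<in> I \<Longrightarrow> h j \<in> carrier (dual_space X)"
  shows "(\<Oplus>\<^bsub>dual_space X\<^esub> j\<in>I. h j) = (\<lambda>x\<in>carrier X. \<Sum>j\<in>I. h j x)"
  using assms
proof (induction I rule: finite_induct)
  case empty
  show ?case
    unfolding abelian_monoid.finsum_empty[OF abelian_monoid_dual] by (simp add: dual_space_simps)
next
  case (insert j I)
  then have "(\<Oplus>\<^bsub>dual_space X\<^esub> i\<in>insert j I. h i)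
      = h j \<oplus>\<^bsub>dual_space X\<^esub> (\<Oplus>\<^bsub>dual_space X\<^esub> i\<in>I. h i)"
    by (intro abelian_monoid.finsum_insert[OF abelian_monoid_dual]) auto
  also have "(\<Oplus>\<^bsub>dual_space X\<^esub> i\<in>I. h i) = (\<lambda>x\<in>carrier X. \<Sum>i\<in>I. h i x)"
    using insert.IH insert.prems by (metis insertCI)
  finally show ?case using insert.hyps by (simp add: dual_space_simps fun_eq_iff)
qed

lemma finsum_in_dual:
  assumes "\<And>j. j \<in> I \<Longrightarrow> h j \<in> carrier (dual_space X)"
  shows "(\<Oplus>\<^bsub>dual_space X\<^esub> j\<in>I. h j) \<in> carrier (dual_space X)"
  using assms by (intro abelian_monoid.finsum_closed[OF abelian_monoid_dual]) auto

text \<open>Two continuous maps into a Hausdorff space that agree on a dense set agree on its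
  closure; off the carrier both functionals are \<open>undefined\<close>.\<close>

lemma adjoint_rel_unique:
  assumes "densely_defined X T" and "adjoint_rel X Y T g h" and "adjoint_rel X Y T g h'"
  shows "h = h'"
proof (rule extensionalityI)
  have dual: "h \<in> carrier (dual_space X)" "h' \<in> carrier (dual_space X)"
    using assms by (auto simp: adjoint_rel_def)
  show "h \<in> extensional (carrier X)" "h' \<in> extensional (carrier X)"
    using dual by (auto intro: dual_spaceD(1))
  fix x assume "x \<in> carrier X"
  then have "x \<in> topo X closure_of dom T"
    using assms(1) by (simp add: densely_defined_def)
  then show "h x = h' x"
  proof (rule forall_in_closure_of_eq)
    show "Hausdorff_space (euclidean :: 'k topology)" by simp
    show "h f = h' f" if "f \<in> dom T" for f
      using assms that by (metis adjoint_rel_def)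
  qed (simp_all add: dual[THEN dual_spaceD(4)])
qed

text \<open>Replaces the description operator in \<open>adjoint_op\<close> by membership in the
  graph, the form in which all later arguments run.\<close>

lemma adjoint_op_eq_Some_iff:
  assumes "densely_defined X T"
  shows "adjoint_op X Y T g = Some h \<longleftrightarrow> adjoint_rel X Y T g h"
proof -
  have "(THE h. adjoint_rel X Y T g h) = h" if "adjoint_rel X Y T g h" for h
    using that adjoint_rel_unique[OF assms] by blast
  then show ?thesis by (auto simp: adjoint_op_def)
qed

text \<open>Composing a continuous functional with a continuous operator gives a continuous
  functional, so every \<open>g\<close> in the dual lies in the domain of the adjoint.\<close>

lemma adjoint_rel_continuous_operator:
  assumes T: "T \<in> continuous_operators X Y" and g: "g \<in> carrier (dual_space Y)"
  shows "adjoint_rel X Y T g (\<lambda>x\<in>carrier X. g (the (T x)))"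
proof -
  have lin: "linear_operator X Y T" and dom: "dom T = carrier X"
    and cont: "continuous_map (topo X) (topo Y) (\<lambda>x. the (T x))"
    using T by (auto simp: continuous_operators_def)
  have ran: "the (T x) \<in> carrier Y" if "x \<in> carrier X" for x
    using linear_operator_closed[OF lin] dom that by simp
  have "(\<lambda>x\<in>carrier X. g (the (T x))) \<in> carrier (dual_space X)"
  proof (rule dual_spaceI)
    show "continuous_map (topo X) euclidean (\<lambda>x\<in>carrier X. g (the (T x)))"
      using continuous_map_compose[OF cont dual_spaceD(4)[OF g]]
      by (intro continuous_map_restrict_carrier) (simp add: o_def)
  qed (use lin dom ran in \<open>auto simp: linear_operator_def dual_spaceD(2,3)[OF g]\<close>)
  then show ?thesis using g dom by (auto simp: adjoint_rel_def)
qed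

end

lemma dom_column_operator: "dom (column_operator I C) = (\<Inter>j\<in>I. dom (C j))"
  by (auto simp: column_operator_def dom_def split: if_splits)

lemma the_column_operator:
  "f \<in> dom (column_operator I C) \<Longrightarrow> the (column_operator I C f) = (\<lambda>j\<in>I. the (C j f))"
  by (auto simp: column_operator_def split: if_splits)

lemma dual_sum_iso_column_operator:
  assumes "\<And>j. j \<in> I \<Longrightarrow> linear_operator F0 (F j) (C j)"
    and "g \<in> (\<Pi>\<^sub>E j\<in>I. carrier (dual_space (F j)))"
    and "f \<in> dom (column_operator I C)"
  shows "the (dual_sum_iso I F g) (the (column_operator I C f)) = (\<Sum>j\<in>I. g j (the (C j f)))"
proof -
  have "the (C j f) \<in> carrier (F j)" if "j \<in> I" for j
    using linear_operator_closed[OF assms(1)[OF that]] assms(3) that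
    by (simp add: dom_column_operator)
  then show ?thesis
    using assms(2,3) by (simp add: dual_sum_iso_def the_column_operator)
qed

text \<open>The inclusion of \<open>column_cross\<close> in the adjoint: on the common domain the
  relations of the entries add up.\<close>

lemma adjoint_rel_column_operator:
  assumes X: "lc_hausdorff_space F0" and F: "\<And>j. j \<in> I \<Longrightarrow> lc_hausdorff_space (F j)"
    and I: "finite I" "I \<noteq> {}"
    and C: "\<And>j. j \<in> I \<Longrightarrow> linear_operator F0 (F j) (C j)"
    and g: "g \<in> (\<Pi>\<^sub>E j\<in>I. carrier (dual_space (F j)))"
    and h: "\<And>j. j \<in> I \<Longrightarrow> adjoint_rel F0 (F j) (C j) (g j) (h j)"
  shows "adjoint_rel F0 (direct_sum I F) (column_operator I C) (the (dual_sum_iso I F g))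
    (\<Oplus>\<^bsub>dual_space F0\<^esub> j\<in>I. h j)"
proof -
  interpret lc_hausdorff_space F0 by (rule X)
  have hD: "h j \<in> carrier (dual_space F0)" if "j \<in> I" for j
    using h[OF that] by (simp add: adjoint_rel_def)
  have "the (dual_sum_iso I F g) \<in> carrier (dual_space (direct_sum I F))"
    using dual_sum_iso_in_dual[of I F g, OF F I(1) g] g by (simp add: dual_sum_iso_def)
  moreover have "the (dual_sum_iso I F g) (the (column_operator I C f))
      = (\<Oplus>\<^bsub>dual_space F0\<^esub> j\<in>I. h j) f"
    if f: "f \<in> dom (column_operator I C)" for f
  proof -
    have fj: "f \<in> dom (C j)" if "j \<in> I" for j
      using f that by (simp add: dom_column_operator)
    \<comment> \<open>An intersection over no index would be \<open>UNIV\<close>; one actual entry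
      is needed to place \<open>f\<close> in the carrier, where \<open>finsum_dual\<close> evaluates
      the sum.\<close>
    obtain i where "i \<in> I" using I(2) by blast
    then have "f \<in> carrier F0"
      using fj C[of i] by (force simp: linear_operator_def dest: submoduleE(1))
    moreover have "(\<Sum>j\<in>I. g j (the (C j f))) = (\<Sum>j\<in>I. h j f)"
      using h fj by (intro sum.cong) (auto simp: adjoint_rel_def)
    ultimately show ?thesis
      using dual_sum_iso_column_operator[OF C g f] finsum_dual[OF I(1) hD] by simp
  qed
  ultimately show ?thesis
    using finsum_in_dual[OF hD] by (simp add: adjoint_rel_def)
qed

text \<open>The converse inclusion at the exceptional index \<open>k\<close>: the relation for the
  column is solved for its \<open>k\<close>-th summand.\<close>

lemma adjoint_rel_entry:
  assumes X: "lc_hausdorff_space F0" and I: "finite I" "k \<in> I"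
    and C: "\<And>j. j \<in> I \<Longrightarrow> linear_operator F0 (F j) (C j)"
    and cont: "\<And>j. j \<in> I - {k} \<Longrightarrow> C j \<in> continuous_operators F0 (F j)"
    and g: "g \<in> (\<Pi>\<^sub>E j\<in>I. carrier (dual_space (F j)))"
    and h: "adjoint_rel F0 (direct_sum I F) (column_operator I C) (the (dual_sum_iso I F g)) h"
  shows "\<exists>h'. adjoint_rel F0 (F k) (C k) (g k) h'"
proof -
  interpret lc_hausdorff_space F0 by (rule X)
  define u where "u j = (\<lambda>x\<in>carrier F0. g j (the (C j x)))" for j
  define s where "s = (\<Oplus>\<^bsub>dual_space F0\<^esub> j\<in>I - {k}. u j)"
  have u: "u j \<in> carrier (dual_space F0)" if "j \<in> I - {k}" for j
    using adjoint_rel_continuous_operator[OF cont[OF that], of "g j"] g that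
    by (auto simp: adjoint_rel_def u_def)
  have s_eq: "s = (\<lambda>x\<in>carrier F0. \<Sum>j\<in>I - {k}. u j x)"
    unfolding s_def using I(1) u by (intro finsum_dual) auto
  have sub: "dom (C k) \<subseteq> carrier F0"
    using C[OF I(2)] by (auto simp: linear_operator_def dest: submoduleE(1))
  have eq: "g k (the (C k f)) = h f - s f" if f: "f \<in> dom (C k)" for f
  proof -
    have "f \<in> carrier F0" using f sub by blast
    \<comment> \<open>All entries other than \<open>C k\<close> are defined on the whole carrier, so
      the column has the same domain as \<open>C k\<close>.\<close>
    then have "f \<in> dom (C j)" if "j \<in> I" for j
      using f cont[of j] that by (cases "j = k") (auto simp: continuous_operators_def)
    then have "f \<in> dom (column_operator I C)"
      by (simp add: dom_column_operator)
    then have "h f = (\<Sum>j\<in>I. g j (the (C j f)))"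
      using h dual_sum_iso_column_operator[OF C g] by (simp add: adjoint_rel_def)
    also have "\<dots> = g k (the (C k f)) + (\<Sum>j\<in>I - {k}. g j (the (C j f)))"
      using I by (rule sum.remove)
    finally show ?thesis
      using \<open>f \<in> carrier F0\<close> by (simp add: s_eq u_def)
  qed
  have "h \<in> carrier (dual_space F0)" "s \<in> carrier (dual_space F0)"
    using h finsum_in_dual[of "I - {k}" u] u by (auto simp: adjoint_rel_def s_def)
  then have "(\<lambda>x\<in>carrier F0. h x - s x) \<in> carrier (dual_space F0)"
    by (rule diff_in_dual)
  then show ?thesis
    using g I(2) sub eq by (intro exI[of _ "\<lambda>x\<in>carrier F0. h x - s x"]) (auto simp: adjoint_rel_def)
qed

lemma dom_adjoint_op: "dom (adjoint_op X Y T) = {g. \<exists>h. adjoint_rel X Y T g h}"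
  by (auto simp: adjoint_op_def dom_def)

theorem proposition4p5:
  fixes F0 :: "('k::real_normed_field, 'a) tvs"
    and F :: "nat \<Rightarrow> ('k, 'b) tvs"
    and C :: "nat \<Rightarrow> 'a \<rightharpoonup> 'b"
    and n :: nat
  assumes "n \<ge> 1"
    and "lc_hausdorff_space F0"
    and "\<And>j. j \<in> {1..n} \<Longrightarrow> lc_hausdorff_space (F j)"
    and "\<And>j. j \<in> {1..n} \<Longrightarrow> linear_operator F0 (F j) (C j)"
    and "\<And>j. j \<in> {1..n} \<Longrightarrow> densely_defined F0 (C j)"
    and "densely_defined F0 (column_operator {1..n} C)"
    and "card {j \<in> {1..n}. C j \<notin> continuous_operators F0 (F j)} \<le> 1"
  shows "column_cross F0 {1..n} F C =
    adjoint_op F0 (direct_sum {1..n} F) (column_operator {1..n} C) \<circ>\<^sub>m dual_sum_iso {1..n} F"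
proof
  fix g
  let ?I = "{1..n}" and ?col = "column_operator {1..n} C"
  interpret lc_hausdorff_space F0 by (rule assms(2))
  note F = assms(3) and C = assms(4)
  have I: "finite ?I" "?I \<noteq> {}" using assms(1) by auto
  let ?D = "\<Pi>\<^sub>E j\<in>?I. carrier (dual_space (F j))"
  let ?A = "\<Pi>\<^sub>E j\<in>?I. dom (adjoint_op F0 (F j) (C j))"
  have sub: "?A \<subseteq> ?D"
    by (rule PiE_mono) (auto simp: dom_adjoint_op adjoint_rel_def)
  let ?B = "{j \<in> ?I. C j \<notin> continuous_operators F0 (F j)}"
  have "\<forall>i\<in>?B. \<forall>j\<in>?B. i = j"
    using assms(7) card_le_Suc0_iff_eq[of ?B] by simp
  \<comment> \<open>If no entry is exceptional, \<open>k\<close> is arbitrary and may lie outside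
    the index set.\<close>
  then obtain k where k: "\<And>j. j \<in> ?I - {k} \<Longrightarrow> C j \<in> continuous_operators F0 (F j)"
    by blast
  show "column_cross F0 ?I F C g = (adjoint_op F0 (direct_sum ?I F) ?col \<circ>\<^sub>m dual_sum_iso ?I F) g"
  \<comment> \<open>\<open>?A\<close> is the domain of the left side. Inside it both sides have the
    same value; outside it the right side must be shown to be undefined too.\<close>
  proof (cases "g \<in> ?A")
    case True
    then have g: "g \<in> ?D" using sub by blast
    have "adjoint_rel F0 (F j) (C j) (g j) (the (adjoint_op F0 (F j) (C j) (g j)))"
      if "j \<in> ?I" for j
    proof -
      have "g j \<in> dom (adjoint_op F0 (F j) (C j))" using True that by (rule PiE_mem)
      then have "adjoint_op F0 (F j) (C j) (g j) = Some (the (adjoint_op F0 (F j) (C j) (g j)))"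
        by auto
      then show ?thesis by (simp only: adjoint_op_eq_Some_iff[OF assms(5)[OF that]])
    qed
    from adjoint_rel_column_operator[OF assms(2) F I C g this]
    have "adjoint_op F0 (direct_sum ?I F) ?col (the (dual_sum_iso ?I F g))
        = Some (\<Oplus>\<^bsub>dual_space F0\<^esub> j\<in>?I. the (adjoint_op F0 (F j) (C j) (g j)))"
      by (simp only: adjoint_op_eq_Some_iff[OF assms(6)])
    then show ?thesis
      using True g by (simp add: column_cross_def row_operator_def dual_sum_iso_def)
  next
    case False
    have "(adjoint_op F0 (direct_sum ?I F) ?col \<circ>\<^sub>m dual_sum_iso ?I F) g = None"
    proof (cases "g \<in> ?D")
      case g: True
      have "adjoint_op F0 (direct_sum ?I F) ?col (the (dual_sum_iso ?I F g)) = None"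
      \<comment> \<open>A value of the adjoint at \<open>g\<close> would put each component of
        \<open>g\<close> into the domain of the adjoint of its entry, hence \<open>g\<close> into
        \<open>?A\<close>.\<close>
      proof (rule ccontr)
        assume "\<not> ?thesis"
        then obtain h where
          h: "adjoint_rel F0 (direct_sum ?I F) ?col (the (dual_sum_iso ?I F g)) h"
          using adjoint_op_eq_Some_iff[OF assms(6)] by blast
        have "\<exists>h'. adjoint_rel F0 (F j) (C j) (g j) h'" if j: "j \<in> ?I" for j
        proof (cases "j = k")
          case True
          then have "k \<in> ?I" using j by simp
          from adjoint_rel_entry[OF assms(2) I(1) this C k g h] show ?thesis
            by (simp only: True)
        next
          case False
          then have "C j \<in> continuous_operators F0 (F j)" using j k by blast
          then show ?thesis
            by (intro exI) (rule adjoint_rel_continuous_operator[OF _ PiE_mem[OF g j]])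
        qed
        then have "g \<in> ?A" using g by (simp add: dom_adjoint_op PiE_iff)
        with False show False by blast
      qed
      then show ?thesis using g by (simp add: dual_sum_iso_def)
    \<comment> \<open>Outside \<open>?D\<close> the identification is itself undefined, and so is
      the composition.\<close>
    qed (simp add: dual_sum_iso_def)
    then show ?thesis using False by (simp add: column_cross_def row_operator_def)
  qed
qed

end
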